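(* For every integer $L \geq 2$, $\delta_{3D}(L) = 2L^3 - 2$. That is, the minimum number of links needed to rigidify an $L\times L\times L$ prismatic assembly (i.e. to make its infinitesimal degrees of freedom equal to $6$) is exactly $2L^3-2$.
   Context: An $L\times M\times N$ prismatic assembly ($L,M,N$ positive integers) consists of $LMN$ solid cubes of side length $l>0$ occupying the cells of the $L\times M\times N$ cubic grid $[0,Ll]\times[0,Ml]\times[0,Nl]$. Each cube has its own $8$ vertices, so the configuration is described by $24LMN$ coordinates (vertices of different cubes are distinct variables even when they occupy the same grid point). A possible link is an unordered pair of vertices belonging to two distinct cubes that occupy the same grid point in the undeformed configuration; a link pattern is a set of such links. The constraints are: for each cube, the $12$ edge-length constraints $\|v_i-v_j\|^2-l^2=0$ for adjacent vertices $v_i,v_j$ of the cube, and the $6$ face-diagonal constraints $\|v_i-v_j\|^2-2l^2=0$ for opposite vertices $v_i,v_j$ of each face of the cube; and for each link joining vertices $v_i=(x_{3i-2},x_{3i-1},x_{3i})$ and $v_j=(x_{3j-2},x_{3j-1},x_{3j})$, the three constraints $x_{3i-2}-x_{3j-2}=0$, $x_{3i-1}-x_{3j-1}=0$, $x_{3i}-x_{3j}=0$. With $n$ links, the rigidity matrix $A$ is the $(18LMN+3n)\times 24LMN$ Jacobian matrix $A_{ij}=\partial g_i/\partial x_j$ of all these constraints $g_i$, evaluated at the undeformed grid configuration, and the (infinitesimal) degrees of freedom are $d = 24LMN - \operatorname{rank}(A)$. The assembly is rigidified by a link pattern if $d=6$. $\delta_{3D}(L,M,N)$ denotes the minimum number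 of links in a link pattern that rigidifies the $L\times M\times N$ assembly, and $\delta_{3D}(L):=\delta_{3D}(L,L,L)$. *)

theory Defs
  imports "Jordan_Normal_Form.DL_Rank" "HOL-Library.Product_Lexorder"
begin

text \<open>Indexing conventions (all 0-based).
  Cube at grid cell (a,b,c), a<L, b<M, c<N, has index q = a + L*b + L*M*c.
  Corner k<8 of a cube has offset (k mod 2, (k div 2) mod 2, k div 4).
  Vertex (variable block) v = 8*q + k, with coordinates x at columns 3*v, 3*v+1, 3*v+2.\<close>

definition cube_cell :: "nat \<Rightarrow> nat \<Rightarrow> nat \<Rightarrow> nat \<times> nat \<times> nat" where
  "cube_cell L M q = (q mod L, (q div L) mod M, q div (L * M))"

definition corner_offset :: "nat \<Rightarrow> nat \<times> nat \<times> nat" where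
  "corner_offset k = (k mod 2, (k div 2) mod 2, k div 4)"

text \<open>Grid point (in units of l) occupied by vertex v in the undeformed configuration.\<close>
definition grid_point :: "nat \<Rightarrow> nat \<Rightarrow> nat \<Rightarrow> nat \<times> nat \<times> nat" where
  "grid_point L M v =
     (case cube_cell L M (v div 8) of (a, b, c) \<Rightarrow>
       (case corner_offset (v mod 8) of (e1, e2, e3) \<Rightarrow> (a + e1, b + e2, c + e3)))"

definition coord :: "nat \<times> nat \<times> nat \<Rightarrow> nat \<Rightarrow> nat" where
  "coord p t = (if t = 0 then fst p else if t = 1 then fst (snd p) else snd (snd p))"

definition pos :: "real \<Rightarrow> nat \<Rightarrow> nat \<Rightarrow> nat \<Rightarrow> nat \<Rightarrow> real" where
  "pos l L M v t = l * real (coord (grid_point L M v) t)"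

text \<open>The 18 constraints of a single cube, as pairs of corners: 12 edges, then one
  diagonal on each of the 6 faces.\<close>
definition cube_pairs :: "(nat \<times> nat) list" where
  "cube_pairs =
    [(0,1),(2,3),(4,5),(6,7), (0,2),(1,3),(4,6),(5,7), (0,4),(1,5),(2,6),(3,7),
     (0,6),(1,7),(0,5),(2,7),(0,3),(4,7)]"

definition cube_sqlen :: "nat \<Rightarrow> nat" where
  "cube_sqlen s = (if s < 12 then 1 else 2)"

text \<open>A link is represented as an ordered pair (i,j) with i<j of vertex indices.
  Possible links: vertices of two distinct cubes at the same grid point.\<close>
definition possible_links :: "nat \<Rightarrow> nat \<Rightarrow> nat \<Rightarrow> (nat \<times> nat) set" where
  "possible_links L M N =
     {(i, j). i < j \<and> j < 8 * (L * M * N) \<and> i div 8 \<noteq> j div 8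
              \<and> grid_point L M i = grid_point L M j}"

text \<open>The rigidity (Jacobian) matrix for link pattern P:
  rows 0..18LMN-1 are the cube constraints (18 per cube, cube q uses rows 18q..18q+17),
  then 3 rows per link (links in increasing order); 24LMN columns.\<close>
definition rigidity_matrix :: "real \<Rightarrow> nat \<Rightarrow> nat \<Rightarrow> nat \<Rightarrow> (nat \<times> nat) set \<Rightarrow> real mat" where
  "rigidity_matrix l L M N P =
    (let K = L * M * N; links = sorted_list_of_set P in
     mat (18 * K + 3 * length links) (24 * K)
       (\<lambda>(r, col).
          if r < 18 * K then
            (let q = r div 18; s = r mod 18;
                 vi = 8 * q + fst (cube_pairs ! s); vj = 8 * q + snd (cube_pairs ! s);
                 w = col div 3; t = col mod 3 in
             if w = vi then 2 * (pos l L M vi t - pos l L M vj t)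
             else if w = vj then - 2 * (pos l L M vi t - pos l L M vj t)
             else 0)
          else
            (let m = (r - 18 * K) div 3; t = (r - 18 * K) mod 3;
                 vi = fst (links ! m); vj = snd (links ! m) in
             if col = 3 * vi + t then 1
             else if col = 3 * vj + t then -1
             else 0)))"

definition dof :: "real \<Rightarrow> nat \<Rightarrow> nat \<Rightarrow> nat \<Rightarrow> (nat \<times> nat) set \<Rightarrow> nat" where
  "dof l L M N P =
     24 * (L * M * N) -
       vec_space.rank (dim_row (rigidity_matrix l L M N P)) (rigidity_matrix l L M N P)"

definition rigidifies :: "real \<Rightarrow> nat \<Rightarrow> nat \<Rightarrow> nat \<Rightarrow> (nat \<times> nat) set \<Rightarrow> bool" where
  "rigidifies l L M N P \<longleftrightarrow> P \<subseteq> possible_links L M N \<and> dof l L M N P = 6"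

definition delta3D :: "real \<Rightarrow> nat \<Rightarrow> nat \<Rightarrow> nat \<Rightarrow> nat" where
  "delta3D l L M N = (LEAST n. \<exists>P. rigidifies l L M N P \<and> card P = n)"

end

theory Submission
  imports Defs "HOL-Library.Product_Plus"
begin

text \<open>The matrix has $18K + 3n$ rows, where $K = LMN$, so rank $24K - 6$ forces $n \ge 2K - 2$.
  For the converse, the kernel vectors are the assignments of an infinitesimal rigid motion (a twist)
  to every cube for which linked vertices have equal velocities, and a pattern of $2K - 2$ links is
  needed for which all twists agree. It is grown from a single cube. A group of $m \ge 3$ new cubes is
  attached by $2m$ links: each new cube is linked once to the part already built, at its vertex of least
  coordinates, and the new cubes are linked in a cycle. For suitably chosen linking points in the cycle
  the resulting linear system in the $3m$ rotation parameters is nonsingular. Three shapes of such groups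
  within a layer of thickness one (a square, an L-tromino in two orientations, and a hexagonal cycle in a
  $3 \times 3$ square) tile every $a \times b$ layer with $a, b \ge 2$, and layers are added in the three
  directions in turn.\<close>

section \<open>Twists and tight sets of cubes\<close>

type_synonym pt = "nat \<times> nat \<times> nat"
type_synonym twist = "(real \<times> real \<times> real) \<times> (real \<times> real \<times> real)"

text \<open>A twist $(t, w)$ is the infinitesimal rigid motion with velocity field $p \mapsto t + w \times p$.\<close>

fun vel :: "twist \<Rightarrow> pt \<Rightarrow> real \<times> real \<times> real" where
  "vel ((t1, t2, t3), (w1, w2, w3)) (x, y, z) =
    (t1 + w2 * real z - w3 * real y, t2 + w3 * real x - w1 * real z, t3 + w1 * real y - w2 * real x)"

text \<open>A cube is named by the corner of its cell with the least coordinates.\<close>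

fun corner_of :: "pt \<Rightarrow> pt \<Rightarrow> bool" where
  "corner_of (x, y, z) (x', y', z') \<longleftrightarrow>
    (x' = x \<or> x' = x + 1) \<and> (y' = y \<or> y' = y + 1) \<and> (z' = z \<or> z' = z + 1)"

definition links_on :: "pt set \<Rightarrow> (pt \<times> pt \<times> pt) set" where
  "links_on S = {(c, d, p). c \<in> S \<and> d \<in> S \<and> c \<noteq> d \<and> corner_of c p \<and> corner_of d p}"

definition compatible :: "(pt \<Rightarrow> twist) \<Rightarrow> (pt \<times> pt \<times> pt) set \<Rightarrow> bool" where
  "compatible T E \<longleftrightarrow> (\<forall>(c, d, p) \<in> E. vel (T c) p = vel (T d) p)"

text \<open>A cube has six twist parameters and a link gives three equations, so at least 2|S| - 2
  links are needed to leave a single common twist. The count is written additively to avoid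
  truncated subtraction, and only as an upper bound, since counting matrix rows supplies the reverse
  inequality at the end.\<close>

definition tight :: "pt set \<Rightarrow> bool" where
  "tight S \<longleftrightarrow> finite S \<and> (\<exists>E \<subseteq> links_on S. finite E \<and> card E + 2 \<le> 2 * card S \<and>
    (\<forall>T. compatible T E \<longrightarrow> (\<forall>c\<in>S. \<forall>d\<in>S. T c = T d)))"

text \<open>The condition \<^term>\<open>vel (D g) g = 0\<close> is the link of the cube \<^term>\<open>g\<close> at its own naming
  corner to a part that is at rest.\<close>

definition gadget :: "pt set \<Rightarrow> bool" where
  "gadget G \<longleftrightarrow> finite G \<and> (\<exists>E \<subseteq> links_on G. finite E \<and> card E \<le> card G \<and>
    (\<forall>D. compatible D E \<longrightarrow> (\<forall>g\<in>G. vel (D g) g = 0) \<longrightarrow> (\<forall>g\<in>G. D g = 0)))"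

lemma twist_exhaust:
  obtains t1 t2 t3 w1 w2 w3 where "(T :: twist) = ((t1, t2, t3), (w1, w2, w3))"
proof -
  obtain t w where "T = (t, w)" by (cases T)
  moreover obtain t1 t2 t3 where "t = (t1, t2, t3)" by (cases t)
  moreover obtain w1 w2 w3 where "w = (w1, w2, w3)" by (cases w)
  ultimately show thesis using that by blast
qed

lemma vel_diff: "vel (S - T) p = vel S p - vel T p"
  by (rule twist_exhaust[of S]; rule twist_exhaust[of T]; cases p) (simp add: algebra_simps)

text \<open>Velocities are linear in the twist, so the common twist of S can be subtracted
  everywhere; the link of a new cube to S then becomes the condition \<open>vel (D g) g = 0\<close>
  of a gadget. One such link for each new cube and at most |G| links inside G raise the count by at
  most 2|G|.\<close>

lemma tight_add:
  assumes S: "tight S" and G: "gadget G" and disj: "S \<inter> G = {}"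
    and cov: "\<And>g. g \<in> G \<Longrightarrow> \<exists>c\<in>S. corner_of c g"
  shows "tight (S \<union> G)"
proof -
  from S obtain E where E: "finite S" "E \<subseteq> links_on S" "finite E" "card E + 2 \<le> 2 * card S"
    "\<And>T. compatible T E \<Longrightarrow> \<forall>c\<in>S. \<forall>d\<in>S. T c = T d"
    unfolding tight_def by blast
  from G obtain F where F: "finite G" "F \<subseteq> links_on G" "finite F" "card F \<le> card G"
    "\<And>D. compatible D F \<Longrightarrow> (\<And>g. g \<in> G \<Longrightarrow> vel (D g) g = 0) \<Longrightarrow> \<forall>g\<in>G. D g = 0"
    unfolding gadget_def by metis
  obtain f where f: "\<And>g. g \<in> G \<Longrightarrow> f g \<in> S \<and> corner_of (f g) g"
    using cov by metis
  \<comment> \<open>Every new cube has its naming corner as a vertex, and \<open>f g\<close> is a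
    cube of S with the same vertex, so a link exists there.\<close>
  define H where "H = (\<lambda>g. (g, f g, g)) ` G"
  have "card (E \<union> F \<union> H) \<le> card E + card F + card H"
    by (meson card_Un_le le_trans add_le_mono1)
  also have "card H \<le> card G" unfolding H_def by (rule card_image_le[OF F(1)])
  finally have card: "card (E \<union> F \<union> H) + 2 \<le> 2 * card (S \<union> G)"
    using E(4) F(4) card_Un_disjoint[OF E(1) F(1) disj] by linarith
  have self: "corner_of g g" for g by (cases g) simp
  have "H \<subseteq> links_on (S \<union> G)"
  proof -
    have "(g, f g, g) \<in> links_on (S \<union> G)" if "g \<in> G" for g
      using f[OF that] self[of g] that disj unfolding links_on_def by auto
    then show ?thesis unfolding H_def by blast
  qed
  then have sub: "E \<union> F \<union> H \<subseteq> links_on (S \<union> G)"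
    using E(2) F(2) unfolding links_on_def by blast
  have rigid: "\<forall>c\<in>S \<union> G. \<forall>d\<in>S \<union> G. T c = T d" if T: "compatible T (E \<union> F \<union> H)" for T
  proof (cases "S = {}")
    case True
    with cov have "G = {}" by auto
    with True show ?thesis by simp
  next
    case False
    then obtain c0 where c0: "c0 \<in> S" by blast
    have const: "T c = T c0" if "c \<in> S" for c
      using E(5)[of T] T that c0 unfolding compatible_def by blast
    have "\<forall>g\<in>G. T g - T c0 = 0"
    proof (rule F(5))
      show "compatible (\<lambda>g. T g - T c0) F"
        using T unfolding compatible_def by (auto simp: vel_diff)
      fix g assume g: "g \<in> G"
      then have "vel (T g) g = vel (T (f g)) g"
        using T unfolding compatible_def H_def by blast
      then show "vel (T g - T c0) g = 0" using const f g by (simp add: vel_diff)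
    qed
    then have "T c = T c0" if "c \<in> S \<union> G" for c
      using const that by (metis Un_iff eq_iff_diff_eq_0)
    then show ?thesis by metis
  qed
  show ?thesis unfolding tight_def
    using card sub rigid E(1,3) F(1,3) by (intro conjI exI[of _ "E \<union> F \<union> H"]) (auto simp: H_def)
qed

section \<open>Invariance under translations and cyclic shifts of the axes\<close>

fun translate :: "pt \<Rightarrow> pt \<Rightarrow> pt" where
  "translate (a, b, c) (x, y, z) = (a + x, b + y, c + z)"

fun cyc :: "pt \<Rightarrow> pt" where
  "cyc (x, y, z) = (z, x, y)"

lemma inj_translate: "inj (translate o')"
proof (rule injI)
  fix p q assume "translate o' p = translate o' q"
  then show "p = q" by (cases o'; cases p; cases q) simp
qed

lemma corner_of_translate [simp]: "corner_of (translate o' c) (translate o' p) = corner_of c p"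
  by (cases o'; cases c; cases p) auto

lemma gadget_translate:
  assumes "gadget G"
  shows "gadget (translate o' ` G)"
proof -
  from assms obtain F where F: "finite G" "F \<subseteq> links_on G" "finite F" "card F \<le> card G"
    "\<And>D. compatible D F \<Longrightarrow> (\<And>g. g \<in> G \<Longrightarrow> vel (D g) g = 0) \<Longrightarrow> \<forall>g\<in>G. D g = 0"
    unfolding gadget_def by metis
  let ?s = "translate o'"
  define H where "H = (\<lambda>(c, d, p). (?s c, ?s d, ?s p)) ` F"
  \<comment> \<open>the twist as seen from the translated origin\<close>
  define \<Phi> :: "twist \<Rightarrow> twist" where "\<Phi> T = (vel T o', snd T)" for T
  have vel_\<Phi>: "vel (\<Phi> T) p = vel T (?s p)" for T p
    by (cases o'; cases p; rule twist_exhaust[of T]) (simp add: \<Phi>_def algebra_simps)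
  have \<Phi>_0: "T = 0" if "\<Phi> T = 0" for T
    using that by (cases o'; rule_tac twist_exhaust[of T]) (simp add: \<Phi>_def zero_prod_def)
  have "\<forall>g\<in>?s ` G. D g = 0" if D: "compatible D H" "\<forall>g\<in>?s ` G. vel (D g) g = 0" for D
  proof -
    have "compatible (\<lambda>g. \<Phi> (D (?s g))) F"
      using D(1) by (fastforce simp: compatible_def H_def vel_\<Phi>)
    then have "\<forall>g\<in>G. \<Phi> (D (?s g)) = 0"
      using D(2) by (intro F(5)) (simp_all add: vel_\<Phi>)
    then show ?thesis using \<Phi>_0 by blast
  qed
  moreover have "card H \<le> card (?s ` G)"
    unfolding H_def using F(4) card_image_le[OF F(3), of "\<lambda>(c, d, p). (?s c, ?s d, ?s p)"]
      card_image[OF inj_on_subset[OF inj_translate subset_UNIV], of o' G] by linarith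
  moreover have "H \<subseteq> links_on (?s ` G)"
    using F(2) unfolding H_def links_on_def by (auto simp: inj_eq[OF inj_translate])
  ultimately show ?thesis
    unfolding gadget_def using F(1,3) by (intro conjI exI[of _ H]) (auto simp: H_def)
qed

lemma inj_cyc: "inj cyc"
proof (rule injI)
  fix p q assume "cyc p = cyc q"
  then show "p = q" by (cases p; cases q) simp
qed

lemma corner_of_cyc [simp]: "corner_of (cyc c) (cyc p) = corner_of c p"
  by (cases c; cases p) auto

text \<open>A cyclic shift of the axes is a proper rotation, so it respects the cross product
  without sign changes and carries twists to twists; \<open>\<rho>\<close> is its inverse on
  vectors. Thanks to this, layers need only be stacked in the third direction.\<close>

lemma tight_cyc:
  assumes "tight S"
  shows "tight (cyc ` S)"
proof -
  from assms obtain E where E: "finite S" "E \<subseteq> links_on S" "finite E" "card E + 2 \<le> 2 * card S"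
    "\<And>T. compatible T E \<Longrightarrow> \<forall>c\<in>S. \<forall>d\<in>S. T c = T d"
    unfolding tight_def by blast
  define H where "H = (\<lambda>(c, d, p). (cyc c, cyc d, cyc p)) ` E"
  define \<rho> :: "real \<times> real \<times> real \<Rightarrow> real \<times> real \<times> real" where "\<rho> = (\<lambda>(a, b, c). (b, c, a))"
  define \<Phi> :: "twist \<Rightarrow> twist" where "\<Phi> = map_prod \<rho> \<rho>"
  have vel_\<Phi>: "vel (\<Phi> T) p = \<rho> (vel T (cyc p))" for T p
    by (cases p; rule twist_exhaust[of T]) (simp add: \<Phi>_def \<rho>_def)
  have \<Phi>_inj: "T = U" if "\<Phi> T = \<Phi> U" for T U
    using that by (rule_tac twist_exhaust[of T]; rule_tac twist_exhaust[of U]) (auto simp: \<Phi>_def \<rho>_def)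
  have "\<forall>c\<in>cyc ` S. \<forall>d\<in>cyc ` S. T c = T d" if T: "compatible T H" for T
  proof -
    have "compatible (\<lambda>c. \<Phi> (T (cyc c))) E"
      using T by (fastforce simp: compatible_def H_def vel_\<Phi>)
    from E(5)[OF this] show ?thesis using \<Phi>_inj by blast
  qed
  moreover have "card H + 2 \<le> 2 * card (cyc ` S)"
    unfolding H_def using E(4) card_image_le[OF E(3), of "\<lambda>(c, d, p). (cyc c, cyc d, cyc p)"]
      card_image[OF inj_on_subset[OF inj_cyc subset_UNIV], of S] by linarith
  moreover have "H \<subseteq> links_on (cyc ` S)"
    using E(2) unfolding H_def links_on_def by (auto simp: inj_eq[OF inj_cyc])
  ultimately show ?thesis
    unfolding tight_def using E(1,3) by (intro conjI exI[of _ H]) (auto simp: H_def)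
qed

section \<open>Nonsingular groups\<close>

text \<open>A rigid motion that fixes a point is a rotation about it: the translation part is minus
  the cross product of w with the point. Each cube of a gadget keeps only its three rotation
  parameters.\<close>

lemma vel_vanish:
  assumes "vel T (x, y, z) = 0"
  obtains w1 w2 w3 where
    "T = ((w3 * real y - w2 * real z, w1 * real z - w3 * real x, w2 * real x - w1 * real y), (w1, w2, w3))"
  using assms by (rule_tac twist_exhaust[of T]) (force simp: zero_prod_def algebra_simps)

lemma gadgetI:
  assumes "finite G" "E \<subseteq> links_on G" "finite E" "card E \<le> card G"
    "\<And>D. compatible D E \<Longrightarrow> (\<And>g. g \<in> G \<Longrightarrow> vel (D g) g = 0) \<Longrightarrow> (\<forall>g\<in>G. D g = 0)"
  shows "gadget G"
  using assms unfolding gadget_def by metis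

lemma gadget_square: "gadget {(0,0,0), (1,0,0), (1,1,0), (0,1,0)}" (is "gadget ?G")
proof (rule gadgetI)
  \<comment> \<open>The heights of the linking points must vary: if all were 0, horizontal rotation
    axes would produce only vertical velocities at them, leaving four equations for eight
    unknowns.\<close>
  let ?E = "{((0,0,0), (1,0,0), (1,0,1)), ((1,0,0), (1,1,0), (2,1,0)),
    ((1,1,0), (0,1,0), (1,2,1)), ((0,1,0), (0,0,0), (0,1,1))} :: (pt \<times> pt \<times> pt) set"
  show "finite ?G" "finite ?E" "card ?E \<le> card ?G" by simp_all
  show "?E \<subseteq> links_on ?G" by (simp add: links_on_def)
  fix D assume D: "compatible D ?E" "\<And>g. g \<in> ?G \<Longrightarrow> vel (D g) g = 0"
  obtain a1 a2 a3 where a: "D (0,0,0) = ((0,0,0), (a1,a2,a3))"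
    using D(2)[of "(0,0,0)"] by (rule_tac vel_vanish[of "D (0,0,0)" 0 0 0]) auto
  obtain b1 b2 b3 where b: "D (1,0,0) = ((0,-b3,b2), (b1,b2,b3))"
    using D(2)[of "(1,0,0)"] by (rule_tac vel_vanish[of "D (1,0,0)" 1 0 0]) auto
  obtain c1 c2 c3 where c: "D (1,1,0) = ((c3,-c3,c2-c1), (c1,c2,c3))"
    using D(2)[of "(1,1,0)"] by (rule_tac vel_vanish[of "D (1,1,0)" 1 1 0]) auto
  obtain d1 d2 d3 where d: "D (0,1,0) = ((d3,0,-d1), (d1,d2,d3))"
    using D(2)[of "(0,1,0)"] by (rule_tac vel_vanish[of "D (0,1,0)" 0 1 0]) auto
  \<comment> \<open>Four links with three components each give a homogeneous system of twelve
    equations in twelve unknowns, which is nonsingular for these points.\<close>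
  have "a1 = 0 \<and> a2 = 0 \<and> a3 = 0 \<and> b1 = 0 \<and> b2 = 0 \<and> b3 = 0 \<and> c1 = 0 \<and> c2 = 0 \<and> c3 = 0 \<and> d1 = 0 \<and> d2 = 0 \<and> d3 = 0"
    using D(1) by (simp add: compatible_def a b c d del: One_nat_def)
  then show "\<forall>g\<in>?G. D g = 0" by (simp add: a b c d zero_prod_def del: One_nat_def)
qed

lemma gadget_corner: "gadget {(0,0,0), (1,0,0), (0,1,0)}" (is "gadget ?G")
proof (rule gadgetI)
  let ?E = "{((0,0,0), (1,0,0), (1,0,1)), ((1,0,0), (0,1,0), (1,1,0)),
    ((0,1,0), (0,0,0), (0,1,1))} :: (pt \<times> pt \<times> pt) set"
  show "finite ?G" "finite ?E" "card ?E \<le> card ?G" by simp_all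
  show "?E \<subseteq> links_on ?G" by (simp add: links_on_def)
  fix D assume D: "compatible D ?E" "\<And>g. g \<in> ?G \<Longrightarrow> vel (D g) g = 0"
  obtain a1 a2 a3 where a: "D (0,0,0) = ((0,0,0), (a1,a2,a3))"
    using D(2)[of "(0,0,0)"] by (rule_tac vel_vanish[of "D (0,0,0)" 0 0 0]) auto
  obtain b1 b2 b3 where b: "D (1,0,0) = ((0,-b3,b2), (b1,b2,b3))"
    using D(2)[of "(1,0,0)"] by (rule_tac vel_vanish[of "D (1,0,0)" 1 0 0]) auto
  obtain d1 d2 d3 where d: "D (0,1,0) = ((d3,0,-d1), (d1,d2,d3))"
    using D(2)[of "(0,1,0)"] by (rule_tac vel_vanish[of "D (0,1,0)" 0 1 0]) auto
  have "a1 = 0 \<and> a2 = 0 \<and> a3 = 0 \<and> b1 = 0 \<and> b2 = 0 \<and> b3 = 0 \<and> d1 = 0 \<and> d2 = 0 \<and> d3 = 0"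
    using D(1) by (simp add: compatible_def a b d del: One_nat_def)
  then show "\<forall>g\<in>?G. D g = 0" by (simp add: a b d zero_prod_def del: One_nat_def)
qed

text \<open>A half-turn of \<open>gadget_corner\<close> does not yield this: it would move the
  vertex of least coordinates, where the motion is required to vanish. A separate choice of linking
  points is needed.\<close>

lemma gadget_opposite_corner: "gadget {(1,0,0), (0,1,0), (1,1,0)}" (is "gadget ?G")
proof (rule gadgetI)
  let ?E = "{((1,0,0), (0,1,0), (1,1,1)), ((0,1,0), (1,1,0), (1,2,0)),
    ((1,1,0), (1,0,0), (2,1,1))} :: (pt \<times> pt \<times> pt) set"
  show "finite ?G" "finite ?E" "card ?E \<le> card ?G" by simp_all
  show "?E \<subseteq> links_on ?G" by (simp add: links_on_def)
  fix D assume D: "compatible D ?E" "\<And>g. g \<in> ?G \<Longrightarrow> vel (D g) g = 0"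
  obtain b1 b2 b3 where b: "D (1,0,0) = ((0,-b3,b2), (b1,b2,b3))"
    using D(2)[of "(1,0,0)"] by (rule_tac vel_vanish[of "D (1,0,0)" 1 0 0]) auto
  obtain c1 c2 c3 where c: "D (1,1,0) = ((c3,-c3,c2-c1), (c1,c2,c3))"
    using D(2)[of "(1,1,0)"] by (rule_tac vel_vanish[of "D (1,1,0)" 1 1 0]) auto
  obtain d1 d2 d3 where d: "D (0,1,0) = ((d3,0,-d1), (d1,d2,d3))"
    using D(2)[of "(0,1,0)"] by (rule_tac vel_vanish[of "D (0,1,0)" 0 1 0]) auto
  have "b1 = 0 \<and> b2 = 0 \<and> b3 = 0 \<and> c1 = 0 \<and> c2 = 0 \<and> c3 = 0 \<and> d1 = 0 \<and> d2 = 0 \<and> d3 = 0"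
    using D(1) by (simp add: compatible_def b c d del: One_nat_def)
  then show "\<forall>g\<in>?G. D g = 0" by (simp add: b c d zero_prod_def del: One_nat_def)
qed

text \<open>This is the 3 by 3 square without an L-tromino at its corner. It is needed because nine
  cells could only be split into three L-trominoes, each containing at most one of the four corners.
  In the cycle, (1,1,0) meets both of its neighbours only along a vertical edge.\<close>

lemma gadget_hexagon: "gadget {(2,0,0), (2,1,0), (2,2,0), (1,2,0), (0,2,0), (1,1,0)}" (is "gadget ?G")
proof (rule gadgetI)
  let ?E = "{((2,0,0), (2,1,0), (2,1,1)), ((2,1,0), (2,2,0), (3,2,0)), ((2,2,0), (1,2,0), (2,2,1)),
    ((1,2,0), (0,2,0), (1,3,0)), ((0,2,0), (1,1,0), (1,2,1)), ((1,1,0), (2,0,0), (2,1,0))}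
    :: (pt \<times> pt \<times> pt) set"
  show "finite ?G" "finite ?E" "card ?E \<le> card ?G" by simp_all
  show "?E \<subseteq> links_on ?G" by (simp add: links_on_def)
  fix D assume D: "compatible D ?E" "\<And>g. g \<in> ?G \<Longrightarrow> vel (D g) g = 0"
  obtain a1 a2 a3 where a: "D (2,0,0) = ((0,-2*a3,2*a2), (a1,a2,a3))"
    using D(2)[of "(2,0,0)"] by (rule_tac vel_vanish[of "D (2,0,0)" 2 0 0]) auto
  obtain b1 b2 b3 where b: "D (2,1,0) = ((b3,-2*b3,2*b2-b1), (b1,b2,b3))"
    using D(2)[of "(2,1,0)"] by (rule_tac vel_vanish[of "D (2,1,0)" 2 1 0]) auto
  obtain c1 c2 c3 where c: "D (2,2,0) = ((2*c3,-2*c3,2*c2-2*c1), (c1,c2,c3))"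
    using D(2)[of "(2,2,0)"] by (rule_tac vel_vanish[of "D (2,2,0)" 2 2 0]) auto
  obtain d1 d2 d3 where d: "D (1,2,0) = ((2*d3,-d3,d2-2*d1), (d1,d2,d3))"
    using D(2)[of "(1,2,0)"] by (rule_tac vel_vanish[of "D (1,2,0)" 1 2 0]) auto
  obtain e1 e2 e3 where e: "D (0,2,0) = ((2*e3,0,-2*e1), (e1,e2,e3))"
    using D(2)[of "(0,2,0)"] by (rule_tac vel_vanish[of "D (0,2,0)" 0 2 0]) auto
  obtain f1 f2 f3 where f: "D (1,1,0) = ((f3,-f3,f2-f1), (f1,f2,f3))"
    using D(2)[of "(1,1,0)"] by (rule_tac vel_vanish[of "D (1,1,0)" 1 1 0]) auto
  have "a1 = 0 \<and> a2 = 0 \<and> a3 = 0 \<and> b1 = 0 \<and> b2 = 0 \<and> b3 = 0 \<and> c1 = 0 \<and> c2 = 0 \<and> c3 = 0 \<and>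
    d1 = 0 \<and> d2 = 0 \<and> d3 = 0 \<and> e1 = 0 \<and> e2 = 0 \<and> e3 = 0 \<and> f1 = 0 \<and> f2 = 0 \<and> f3 = 0"
    using D(1) by (simp add: compatible_def a b c d e f del: One_nat_def)
  then show "\<forall>g\<in>?G. D g = 0" by (simp add: a b c d e f zero_prod_def del: One_nat_def)
qed

section \<open>Growing a cube by layers\<close>

definition rect :: "nat \<Rightarrow> nat \<Rightarrow> nat \<Rightarrow> nat \<Rightarrow> nat \<Rightarrow> pt set" where
  "rect x y z a b = {x..<x + a} \<times> {y..<y + b} \<times> {z}"

text \<open>The side conditions of \<open>tight_add\<close>, bundled so that they pass from a
  rectangle to the tiles placed in it one after another.\<close>

definition covers :: "pt set \<Rightarrow> pt set \<Rightarrow> bool" where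
  "covers S G \<longleftrightarrow> S \<inter> G = {} \<and> (\<forall>g\<in>G. \<exists>c\<in>S. corner_of c g)"

lemma coversD_subset: "covers S G \<Longrightarrow> H \<subseteq> G \<Longrightarrow> covers S H"
  unfolding covers_def by blast

lemma coversD_Un: "covers S (G \<union> H) \<Longrightarrow> G \<inter> H = {} \<Longrightarrow> covers (S \<union> G) H"
  unfolding covers_def by blast

lemma tight_add_translate:
  assumes "tight S" "gadget G" "covers S (translate p ` G)"
  shows "tight (S \<union> translate p ` G)"
  using assms(3) unfolding covers_def by (intro tight_add assms(1) gadget_translate assms(2)) blast+

lemma tight_add_translate_Un:
  assumes "tight S" "gadget G" "gadget H" "G \<inter> H = {}" "covers S (translate p ` (G \<union> H))"
  shows "tight (S \<union> translate p ` (G \<union> H))"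
proof -
  have "translate p ` G \<inter> translate p ` H = {}"
    using assms(4) by (simp flip: image_Int[OF inj_translate])
  moreover have cov: "covers S (translate p ` G \<union> translate p ` H)"
    using assms(5) by (simp add: image_Un)
  ultimately have "covers (S \<union> translate p ` G) (translate p ` H)"
    by (intro coversD_Un)
  moreover have "tight (S \<union> translate p ` G)"
    using assms(1,2) coversD_subset[OF cov] by (intro tight_add_translate) simp_all
  ultimately have "tight (S \<union> translate p ` G \<union> translate p ` H)"
    using tight_add_translate[OF _ assms(3)] by blast
  then show ?thesis by (simp add: image_Un Un_assoc)
qed

lemma rect_eq_translate: "rect x y z a b = translate (x, y, z) ` ({..<a} \<times> {..<b} \<times> {0})"
proof -
  have "(u, v, z) \<in> translate (x, y, z) ` ({..<a} \<times> {..<b} \<times> {0})"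
    if "x \<le> u" "u < x + a" "y \<le> v" "v < y + b" for u v
    using that by (intro image_eqI[of _ _ "(u - x, v - y, 0)"]) auto
  then show ?thesis by (auto simp: rect_def)
qed

lemma lessThan_2: "{..<2} = {0, 1 :: nat}" and lessThan_3: "{..<3} = {0, 1, 2 :: nat}"
  by auto

text \<open>The tilings: one square for 2 by 2, two opposite L-trominoes for 2 by 3 and 3 by 2, and
  an L-tromino with the hexagonal cycle for 3 by 3.\<close>

lemma tight_add_small_rect:
  assumes S: "tight S" and cov: "covers S (rect x y z a b)" and "a = 2 \<or> a = 3" "b = 2 \<or> b = 3"
  shows "tight (S \<union> rect x y z a b)"
proof -
  let ?corner = "{(0,0,0), (1,0,0), (0,1,0)} :: pt set"
  consider "a = 2 \<and> b = 2" | "a = 2 \<and> b = 3" | "a = 3 \<and> b = 2" | "a = 3 \<and> b = 3"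
    using assms(3,4) by blast
  then show ?thesis
  proof cases
    case 1
    have "{..<a} \<times> {..<b} \<times> {0} = ({(0,0,0), (1,0,0), (1,1,0), (0,1,0)} :: pt set)"
      using 1 by (auto simp: lessThan_2 simp del: lessThan_iff)
    with S cov gadget_square show ?thesis
      unfolding rect_eq_translate by (metis tight_add_translate)
  next
    case 2
    have "gadget {(1,1,0), (0,2,0), (1,2,0)}"
      using gadget_translate[OF gadget_opposite_corner, of "(0,1,0)"] by (simp add: numeral_2_eq_2)
    moreover have "{..<a} \<times> {..<b} \<times> {0} = ?corner \<union> {(1,1,0), (0,2,0), (1,2,0)}"
      using 2 by (auto simp: lessThan_2 lessThan_3 simp del: lessThan_iff)
    moreover have "?corner \<inter> {(1,1,0), (0,2,0), (1,2,0)} = {}" by simp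
    ultimately show ?thesis
      using S cov gadget_corner unfolding rect_eq_translate by (metis tight_add_translate_Un)
  next
    case 3
    have "gadget {(2,0,0), (1,1,0), (2,1,0)}"
      using gadget_translate[OF gadget_opposite_corner, of "(1,0,0)"] by (simp add: numeral_2_eq_2)
    moreover have "{..<a} \<times> {..<b} \<times> {0} = ?corner \<union> {(2,0,0), (1,1,0), (2,1,0)}"
      using 3 by (auto simp: lessThan_2 lessThan_3 simp del: lessThan_iff)
    moreover have "?corner \<inter> {(2,0,0), (1,1,0), (2,1,0)} = {}" by simp
    ultimately show ?thesis
      using S cov gadget_corner unfolding rect_eq_translate by (metis tight_add_translate_Un)
  next
    case 4
    let ?hexagon = "{(2,0,0), (2,1,0), (2,2,0), (1,2,0), (0,2,0), (1,1,0)} :: pt set"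
    have "{..<a} \<times> {..<b} \<times> {0} = ?corner \<union> ?hexagon"
      using 4 by (auto simp: lessThan_2 lessThan_3 simp del: lessThan_iff)
    moreover have "?corner \<inter> ?hexagon = {}" by simp
    ultimately show ?thesis
      using S cov gadget_corner gadget_hexagon
      unfolding rect_eq_translate by (metis tight_add_translate_Un)
  qed
qed

text \<open>Strips of width 2 are cut off while a side is at least 4, so that no side drops below 2.
  The induction generalizes S, since the second piece is attached to a set that already contains the
  first.\<close>

lemma tight_add_rect:
  assumes "tight S" "covers S (rect x y z a b)" "2 \<le> a" "2 \<le> b"
  shows "tight (S \<union> rect x y z a b)"
  using assms
proof (induction "a + b" arbitrary: S x y a b rule: less_induct)
  case less
  have step: "tight (S \<union> rect x y z a b)"
    if split: "rect x y z a b = rect x y z a1 b1 \<union> rect x2 y2 z a2 b2"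
      "rect x y z a1 b1 \<inter> rect x2 y2 z a2 b2 = {}"
      and small: "a1 + b1 < a + b" "a2 + b2 < a + b" "2 \<le> a1" "2 \<le> b1" "2 \<le> a2" "2 \<le> b2"
    for a1 b1 x2 y2 a2 b2
  proof -
    have cov: "covers S (rect x y z a1 b1 \<union> rect x2 y2 z a2 b2)"
      using less.prems(2) split(1) by simp
    have "tight (S \<union> rect x y z a1 b1)"
      using less.hyps[OF small(1) less.prems(1) _ small(3,4)] coversD_subset[OF cov] by blast
    from less.hyps[OF small(2) this coversD_Un[OF cov split(2)] small(5,6)]
    show ?thesis by (simp only: split(1) Un_assoc)
  qed
  consider "4 \<le> a" | "4 \<le> b" | "a = 2 \<or> a = 3" "b = 2 \<or> b = 3"
    using less.prems(3,4) by linarith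
  then show ?case
  proof cases
    case 1
    then show ?thesis
      using less.prems by (intro step[of 2 b "x + 2" y "a - 2" b]) (auto simp: rect_def)
  next
    case 2
    then show ?thesis
      using less.prems by (intro step[of a 2 x "y + 2" a "b - 2"]) (auto simp: rect_def)
  next
    case 3
    then show ?thesis by (rule tight_add_small_rect[OF less.prems(1,2)])
  qed
qed

definition box :: "nat \<Rightarrow> nat \<Rightarrow> nat \<Rightarrow> pt set" where
  "box a b c = {..<a} \<times> {..<b} \<times> {..<c}"

lemma cyc_box: "cyc ` box a b c = box c a b"
proof -
  have "(x, y, z) \<in> cyc ` box a b c" if "(x, y, z) \<in> box c a b" for x y z
    using that by (intro image_eqI[of _ _ "(y, z, x)"]) (auto simp: box_def)
  then show ?thesis by (auto simp: box_def)
qed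

lemma tight_box_rotate: "tight (box a b c) \<Longrightarrow> tight (box c a b)"
  by (metis tight_cyc cyc_box)

lemma tight_box_heighten:
  assumes "tight (box a b c)" "2 \<le> a" "2 \<le> b" "1 \<le> c" "c \<le> c'"
  shows "tight (box a b c')"
  using assms(5)
proof (induction c' rule: dec_induct)
  case base
  show ?case by fact
next
  case (step n)
  \<comment> \<open>The cube directly below has the naming corner of the new cube among its top
    vertices; there is such a cube because n is at least 1.\<close>
  have "corner_of (x, y, n - 1) (x, y, n)" for x y
    using step assms(4) by simp
  then have "covers (box a b n) (rect 0 0 n a b)"
    using step assms(4) unfolding covers_def box_def rect_def
    by (force simp del: corner_of.simps)
  from tight_add_rect[OF step.IH this assms(2,3)]
  show ?case by (rule back_subst[of tight]) (auto simp: box_def rect_def)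
qed

text \<open>A single cube is tight with no links, which exhausts its count exactly. The other three
  cubes all have their naming corners among its vertices.\<close>

lemma tight_box_221: "tight (box 2 2 1)"
proof -
  have "tight {(0, 0, 0)}"
    unfolding tight_def by (auto simp: compatible_def intro!: exI[of _ "{}"])
  then have "tight ({(0, 0, 0)} \<union> {(1, 0, 0), (0, 1, 0), (1, 1, 0)})"
    by (rule tight_add[OF _ gadget_opposite_corner]) auto
  then show ?thesis
    by (rule back_subst[of tight]) (auto simp: box_def)
qed

text \<open>A layer needs both sides at least 2, so growth alternates with rotation: 2 2 1, 2 2 n, n
  2 2, n 2 n, n n 2, n n n.\<close>

lemma tight_cube:
  assumes "2 \<le> n"
  shows "tight (box n n n)"
proof -
  have "tight (box 2 2 n)" using tight_box_heighten[OF tight_box_221] assms by simp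
  then have "tight (box n 2 2)" by (rule tight_box_rotate)
  then have "tight (box n 2 n)" by (rule tight_box_heighten) (use assms in auto)
  then have "tight (box n n 2)" by (rule tight_box_rotate)
  then show ?thesis by (rule tight_box_heighten) (use assms in auto)
qed

section \<open>The rank and the rows of the rigidity matrix\<close>

lemma rank_le_nr:
  fixes A :: "'a :: field mat"
  assumes "A \<in> carrier_mat nr nc"
  shows "vec_space.rank nr A \<le> nr"
proof -
  interpret vec_space "TYPE('a)" nr .
  have "lin_indpt {}" by (rule finite_lin_indpt2) auto
  then obtain S where S: "maximal S (\<lambda>T. T \<subseteq> set (cols A) \<and> lin_indpt T)"
    using maximal_exists[of "\<lambda>T. T \<subseteq> set (cols A) \<and> lin_indpt T" "card (set (cols A))" "{}"]
    by (metis (no_types, lifting) List.finite_set card_mono empty_subsetI finite_subset)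
  then have "S \<subseteq> carrier_vec nr" "lin_indpt S"
    using cols_dim assms unfolding maximal_def by blast+
  then have "card S \<le> nr" using li_le_dim(2) dim_is_n fin_dim by (metis carrier_vec_def)
  then show ?thesis using rank_card_indpt[OF assms S] by simp
qed

text \<open>If the system restricted to the unknowns in J has only the zero solution, the columns
  indexed by J are independent. Independence concerns a set of vectors, so these columns must also
  be shown distinct.\<close>

lemma card_le_rank:
  fixes A :: "'a :: field mat"
  assumes A: "A \<in> carrier_mat nr nc" and J: "J \<subseteq> {..<nc}"
    and indep: "\<And>x. (\<And>i. i < nr \<Longrightarrow> (\<Sum>j\<in>J. A $$ (i, j) * x j) = 0) \<Longrightarrow> \<forall>j\<in>J. x j = 0"
  shows "card J \<le> vec_space.rank nr A"
proof -
  interpret vec_space "TYPE('a)" nr .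
  have fin: "finite J" using J finite_subset by blast
  have inj: "inj_on (col A) J"
  proof (rule inj_onI, rule ccontr)
    fix j k assume jk: "j \<in> J" "k \<in> J" "col A j = col A k" "j \<noteq> k"
    \<comment> \<open>If columns j and k coincided, the difference of the two unit vectors would be
      a nonzero solution.\<close>
    define x where "x = (\<lambda>i. (if i = j then 1 else 0) - (if i = k then 1 else 0) :: 'a)"
    have "(\<Sum>j\<in>J. A $$ (i, j) * x j) = 0" if "i < nr" for i
    proof -
      have "A $$ (i, q) * x q = (if q = j then A $$ (i, j) else 0) - (if q = k then A $$ (i, k) else 0)" for q
        by (simp add: x_def)
      then have "(\<Sum>j\<in>J. A $$ (i, j) * x j) = A $$ (i, j) - A $$ (i, k)"
        using fin jk(1,2) by (simp add: sum_subtractf)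
      also have "\<dots> = col A j $ i - col A k $ i"
        using A J jk(1,2) that by (simp add: subset_iff)
      finally show ?thesis using jk(3) by simp
    qed
    from indep[OF this] jk show False by (auto simp: x_def)
  qed
  have sub: "col A ` J \<subseteq> set (cols A)"
    using A J by (auto simp: cols_def)
  then have carr: "col A ` J \<subseteq> carrier_vec nr" using cols_dim[of A] A by auto
  have "lin_indpt (col A ` J)"
  proof (rule finite_lin_indpt2)
    fix a assume lc: "lincomb a (col A ` J) = 0\<^sub>v nr"
    have "(\<Sum>j\<in>J. A $$ (i, j) * a (col A j)) = 0" if "i < nr" for i
    proof -
      have "(\<Sum>j\<in>J. A $$ (i, j) * a (col A j)) = (\<Sum>j\<in>J. a (col A j) * col A j $ i)"
        using A J that by (intro sum.cong) auto
      also have "\<dots> = lincomb a (col A ` J) $ i"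
        using lincomb_index[OF that carr] by (simp add: sum.reindex[OF inj])
      finally show ?thesis using lc that by simp
    qed
    from indep[OF this] show "\<forall>v\<in>col A ` J. a v = 0" by simp
  qed (use fin carr in auto)
  from rank_ge_card_indpt[OF A sub this] show ?thesis
    by (simp add: card_image[OF inj])
qed


lemma sum_triples:
  fixes f :: "nat \<Rightarrow> real"
  shows "(\<Sum>c<3 * n. f c) = (\<Sum>w<n. f (3 * w) + f (3 * w + 1) + f (3 * w + 2))"
proof (induction n)
  case (Suc n)
  have "3 * Suc n = Suc (Suc (Suc (3 * n)))" by simp
  then show ?case using Suc by (simp only: sum.lessThan_Suc) (simp add: add.assoc)
qed simp

lemma sum_lessThan_3: "(\<Sum>t<3. f t) = f 0 + f 1 + f (2 :: nat)" for f :: "nat \<Rightarrow> real"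
  by (simp add: numeral_3_eq_3 numeral_2_eq_2)

lemma sum_two_points:
  fixes f :: "nat \<Rightarrow> real"
  assumes "i < n" "j < n" "i \<noteq> j" "\<And>w. w \<noteq> i \<Longrightarrow> w \<noteq> j \<Longrightarrow> f w = 0"
  shows "(\<Sum>w<n. f w) = f i + f j"
proof -
  have "(\<Sum>w<n. f w) = sum f {i, j}"
    using assms by (intro sum.mono_neutral_right) auto
  with assms(3) show ?thesis by simp
qed

lemma cube_pairs_bounds:
  assumes "s < 18"
  shows "fst (cube_pairs ! s) < 8" "snd (cube_pairs ! s) < 8" "fst (cube_pairs ! s) \<noteq> snd (cube_pairs ! s)"
proof -
  have "\<forall>p\<in>set cube_pairs. fst p < 8 \<and> snd p < 8 \<and> fst p \<noteq> snd p" by (simp add: cube_pairs_def)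
  moreover have "cube_pairs ! s \<in> set cube_pairs" using assms by (intro nth_mem) (simp add: cube_pairs_def)
  ultimately show "fst (cube_pairs ! s) < 8" "snd (cube_pairs ! s) < 8"
    "fst (cube_pairs ! s) \<noteq> snd (cube_pairs ! s)" by blast+
qed

lemma rigidity_matrix_carrier:
  "rigidity_matrix l L M N P \<in> carrier_mat (18 * (L * M * N) + 3 * card P) (24 * (L * M * N))"
  by (simp add: rigidity_matrix_def Let_def)

text \<open>This is the linearized length constraint: twice the inner product of the position
  difference and the velocity difference of the two vertices.\<close>

lemma cube_row:
  fixes x :: "nat \<Rightarrow> real"
  assumes q: "q < L * M * N" and s: "s < 18"
  defines "i \<equiv> 8 * q + fst (cube_pairs ! s)" and "j \<equiv> 8 * q + snd (cube_pairs ! s)"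
  shows "(\<Sum>c<24 * (L * M * N). rigidity_matrix l L M N P $$ (18 * q + s, c) * x c) =
    2 * (\<Sum>t<3. (pos l L M i t - pos l L M j t) * (x (3 * i + t) - x (3 * j + t)))"
proof -
  let ?K = "L * M * N"
  let ?f = "\<lambda>c. (if c div 3 = i then 2 * (pos l L M i (c mod 3) - pos l L M j (c mod 3))
    else if c div 3 = j then - 2 * (pos l L M i (c mod 3) - pos l L M j (c mod 3)) else 0) * x c"
  have dm: "3 * w div 3 = w" "Suc (3 * w) div 3 = w" "Suc (Suc (3 * w)) div 3 = w" "3 * w mod 3 = 0"
    "Suc (3 * w) mod 3 = 1" "Suc (Suc (3 * w)) mod 3 = 2" for w :: nat by presburger+
  have ij: "i < 8 * ?K" "j < 8 * ?K" "i \<noteq> j"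
    using cube_pairs_bounds[OF s] q unfolding i_def j_def by linarith+
  have "18 * q + s < 18 * ?K" using q s by linarith
  moreover have "(18 * q + s) div 18 = q" "(18 * q + s) mod 18 = s" using s by simp_all
  ultimately have "(\<Sum>c<24 * ?K. rigidity_matrix l L M N P $$ (18 * q + s, c) * x c) = (\<Sum>c<24 * ?K. ?f c)"
    by (intro sum.cong) (simp_all add: rigidity_matrix_def Let_def i_def j_def)
  also have "\<dots> = (\<Sum>w<8 * ?K. ?f (3 * w) + ?f (3 * w + 1) + ?f (3 * w + 2))"
    using sum_triples[of ?f "8 * ?K"] by (simp only: mult.assoc[symmetric]) simp
  also have "\<dots> = (?f (3 * i) + ?f (3 * i + 1) + ?f (3 * i + 2)) + (?f (3 * j) + ?f (3 * j + 1) + ?f (3 * j + 2))"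
    using ij by (intro sum_two_points) (simp_all add: dm)
  also have "\<dots> = 2 * (\<Sum>t<3. (pos l L M i t - pos l L M j t) * (x (3 * i + t) - x (3 * j + t)))"
    using ij(3) by (simp add: dm sum_lessThan_3, simp add: algebra_simps)
  finally show ?thesis .
qed

lemma link_row:
  fixes x :: "nat \<Rightarrow> real"
  assumes "finite P" "(i, j) \<in> P" "i < j" "j < 8 * (L * M * N)" "t < 3"
  obtains r where "r < 18 * (L * M * N) + 3 * card P"
    "(\<Sum>c<24 * (L * M * N). rigidity_matrix l L M N P $$ (r, c) * x c) = x (3 * i + t) - x (3 * j + t)"
proof -
  let ?K = "L * M * N"
  obtain m where m: "m < card P" "sorted_list_of_set P ! m = (i, j)"
    using assms(1,2) by (metis in_set_conv_nth length_sorted_list_of_set set_sorted_list_of_set)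
  define r where "r = 18 * ?K + (3 * m + t)"
  have r: "r < 18 * ?K + 3 * card P" using m(1) assms(5) by (simp add: r_def)
  have "(r - 18 * ?K) div 3 = m" "(r - 18 * ?K) mod 3 = t" using assms(5) by (simp_all add: r_def)
  then have "(\<Sum>c<24 * ?K. rigidity_matrix l L M N P $$ (r, c) * x c) =
    (\<Sum>c<24 * ?K. (if c = 3 * i + t then 1 else if c = 3 * j + t then -1 else 0) * x c)"
    using m r by (intro sum.cong) (simp_all add: rigidity_matrix_def Let_def, simp_all add: r_def)
  also have "\<dots> = x (3 * i + t) - x (3 * j + t)"
  proof (subst sum_two_points)
    show "3 * i + t < 24 * ?K" "3 * j + t < 24 * ?K" "3 * i + t \<noteq> 3 * j + t"
      using assms(3-5) by linarith+
  qed (use assms(3) in auto)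
  finally show ?thesis using that r by blast
qed

section \<open>From twists to kernel vectors\<close>

text \<open>A cube with its edges and one diagonal on each face is infinitesimally rigid: the edge
  equations identify velocity components along edges, and the diagonals exclude shearing of the
  faces.\<close>

lemma cube_twist:
  fixes v :: "nat \<Rightarrow> nat \<Rightarrow> real"
  assumes rows: "\<And>s. s < 18 \<Longrightarrow>
    (\<Sum>t<3. (real (coord (corner_offset (fst (cube_pairs ! s))) t) - real (coord (corner_offset (snd (cube_pairs ! s))) t)) *
      (v (fst (cube_pairs ! s)) t - v (snd (cube_pairs ! s)) t)) = 0"
  obtains T where "\<And>k. k < 8 \<Longrightarrow> (v k 0, v k 1, v k 2) = vel T (translate p (corner_offset k))"
proof -
  obtain a b c where p: "p = (a, b, c)" by (cases p)
  \<comment> \<open>The rotation is read off from the velocities of corners 1 and 2 relative to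
    corner 0; the translation part of \<open>T\<close> is the velocity of corner 0 minus the cross
    product of the rotation with p.\<close>
  define w1 where "w1 = v 2 2 - v 0 2"
  define w2 where "w2 = v 0 2 - v 1 2"
  define w3 where "w3 = v 1 1 - v 0 1"
  define T where "T = ((v 0 0 - w2 * real c + w3 * real b, v 0 1 - w3 * real a + w1 * real c,
    v 0 2 - w1 * real b + w2 * real a), (w1, w2, w3))"
  note ev = sum_lessThan_3 cube_pairs_def corner_offset_def coord_def
  have eqs: "v 0 0 = v 1 0" "v 2 0 = v 3 0" "v 4 0 = v 5 0" "v 6 0 = v 7 0"
    "v 0 1 = v 2 1" "v 1 1 = v 3 1" "v 4 1 = v 6 1" "v 5 1 = v 7 1"
    "v 0 2 = v 4 2" "v 1 2 = v 5 2" "v 2 2 = v 6 2" "v 3 2 = v 7 2"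
    "v 0 1 + v 0 2 = v 6 1 + v 6 2" "v 1 1 + v 1 2 = v 7 1 + v 7 2"
    "v 0 0 + v 0 2 = v 5 0 + v 5 2" "v 2 0 + v 2 2 = v 7 0 + v 7 2"
    "v 0 0 + v 0 1 = v 3 0 + v 3 1" "v 4 0 + v 4 1 = v 7 0 + v 7 1"
    using rows[of 0] rows[of 1] rows[of 2] rows[of 3] rows[of 4] rows[of 5] rows[of 6] rows[of 7]
      rows[of 8] rows[of 9] rows[of 10] rows[of 11] rows[of 12] rows[of 13] rows[of 14] rows[of 15]
      rows[of 16] rows[of 17]
    by (simp_all add: ev)
  have "(v k 0, v k 1, v k 2) = vel T (translate p (corner_offset k))" if "k < 8" for k
  proof -
    have "k \<in> {0, 1, 2, 3, 4, 5, 6, 7}" using that by auto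
    then show ?thesis
      using eqs by (auto simp: T_def p corner_offset_def w1_def w2_def w3_def algebra_simps)
  qed
  then show ?thesis using that by blast
qed

section \<open>Numbering of cells, vertices and links\<close>

definition cell_index :: "nat \<Rightarrow> nat \<Rightarrow> pt \<Rightarrow> nat" where
  "cell_index L M = (\<lambda>(a, b, c). a + L * b + L * M * c)"

lemma cube_cell_index:
  assumes "c \<in> box L M N"
  shows "cube_cell L M (cell_index L M c) = c"
proof -
  obtain x y z where c: "c = (x, y, z)" "x < L" "y < M"
    using assms by (auto simp: box_def)
  have "cell_index L M c = x + L * (y + M * z)"
    by (simp add: c(1) cell_index_def algebra_simps)
  then show ?thesis
    using c by (simp add: cube_cell_def div_mult2_eq)
qed

lemma cell_index_less:
  assumes "c \<in> box L M N"
  shows "cell_index L M c < L * M * N"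
proof -
  obtain x y z where c: "c = (x, y, z)" "x < L" "y < M" "z < N"
    using assms by (auto simp: box_def)
  have "x + L * y < L * (y + 1)" using c by simp
  also have "\<dots> \<le> L * M" using c by (intro mult_le_mono2) simp
  finally have "x + L * y + L * M * z < L * M * (z + 1)" by simp
  also have "\<dots> \<le> L * M * N" using c by (intro mult_le_mono2) simp
  finally show ?thesis by (simp add: c(1) cell_index_def)
qed

lemma cube_cell_in_box:
  assumes "q < L * M * N"
  shows "cube_cell L M q \<in> box L M N"
proof -
  have "0 < L" "0 < M" using assms by (auto intro: gr0I)
  moreover have "q div (L * M) < N" using assms by (simp add: less_mult_imp_div_less mult.commute)
  ultimately show ?thesis by (simp add: cube_cell_def box_def)
qed

lemma cell_index_cube_cell: "cell_index L M (cube_cell L M q) = q"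
proof -
  have "q mod L + L * (q div L mod M) + L * M * (q div (L * M)) = q mod (L * M) + L * M * (q div (L * M))"
    by (simp add: mod_mult2_eq)
  then show ?thesis by (simp add: cell_index_def cube_cell_def)
qed

lemma grid_point_vertex:
  "k < 8 \<Longrightarrow> grid_point L M (8 * q + k) = translate (cube_cell L M q) (corner_offset k)"
  by (simp add: grid_point_def split: prod.split)

text \<open>The subtractions are exact under \<open>corner_of\<close>, where each of them is 0 or 1;
  the number is then the binary code inverted by \<open>corner_offset\<close>.\<close>

fun corner_number :: "pt \<Rightarrow> pt \<Rightarrow> nat" where
  "corner_number (a, b, c) (x, y, z) = (x - a) + 2 * (y - b) + 4 * (z - c)"

lemma corner_number:
  assumes "corner_of c p"
  shows "corner_number c p < 8" "translate c (corner_offset (corner_number c p)) = p"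
  using assms by (cases c; cases p; auto simp: corner_offset_def)+

definition vertex :: "nat \<Rightarrow> nat \<Rightarrow> pt \<Rightarrow> pt \<Rightarrow> nat" where
  "vertex L M c p = 8 * cell_index L M c + corner_number c p"

lemma vertex:
  assumes "c \<in> box L M N" "corner_of c p"
  shows "vertex L M c p div 8 = cell_index L M c" "vertex L M c p < 8 * (L * M * N)"
    "grid_point L M (vertex L M c p) = p"
  using corner_number[OF assms(2)] cell_index_less[OF assms(1)] cube_cell_index[OF assms(1)]
  by (simp_all add: vertex_def grid_point_vertex)

text \<open>Possible links are ordered pairs with i < j, hence the minimum and maximum. The triples
  (c, d, p) and (d, c, p) give the same link, so the pattern may be smaller than E.\<close>

definition link_pattern :: "nat \<Rightarrow> nat \<Rightarrow> (pt \<times> pt \<times> pt) set \<Rightarrow> (nat \<times> nat) set" where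
  "link_pattern L M E = (\<lambda>(c, d, p). (min (vertex L M c p) (vertex L M d p),
     max (vertex L M c p) (vertex L M d p))) ` E"

lemma link_pattern_possible:
  assumes "E \<subseteq> links_on (box L M N)"
  shows "link_pattern L M E \<subseteq> possible_links L M N"
proof -
  have "(min (vertex L M c p) (vertex L M d p), max (vertex L M c p) (vertex L M d p)) \<in> possible_links L M N"
    if "(c, d, p) \<in> E" for c d p
  proof -
    have cd: "c \<in> box L M N" "d \<in> box L M N" "c \<noteq> d" "corner_of c p" "corner_of d p"
      using that assms by (auto simp: links_on_def)
    then have "vertex L M c p div 8 \<noteq> vertex L M d p div 8"
      using cube_cell_index vertex(1) by metis
    moreover from this have "vertex L M c p \<noteq> vertex L M d p" by metis
    ultimately show ?thesis
      using vertex(2,3)[OF cd(1,4)] vertex(2,3)[OF cd(2,5)]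
      by (auto simp: possible_links_def min_def max_def)
  qed
  then show ?thesis by (auto simp: link_pattern_def)
qed

text \<open>Three coordinates of vertex 0, two of vertex 1 and one of vertex 2: they determine the twist of
  the first cube.\<close>

definition pinned :: "nat set" where "pinned = {0, 1, 2, 4, 5, 8}"

text \<open>It makes the columns outside \<open>pinned\<close> independent. The cube rows turn a
  kernel vector into one twist per cube, the link rows make the twists compatible, tightness makes
  them equal, and the pinned coordinates make the twist of the first cube zero.\<close>

lemma motion_zero:
  fixes x :: "nat \<Rightarrow> real"
  assumes l: "l > 0" and K: "0 < L * M * N"
    and E: "E \<subseteq> links_on (box L M N)" "finite E"
      "\<And>T. compatible T E \<Longrightarrow> \<forall>c\<in>box L M N. \<forall>d\<in>box L M N. T c = T d"
    and P: "P = link_pattern L M E"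
    and rows: "\<And>r. r < 18 * (L * M * N) + 3 * card P \<Longrightarrow>
      (\<Sum>c<24 * (L * M * N). rigidity_matrix l L M N P $$ (r, c) * x c) = 0"
    and pin: "\<And>j. j \<in> pinned \<Longrightarrow> x j = 0"
    and j: "j < 24 * (L * M * N)"
  shows "x j = 0"
proof -
  let ?K = "L * M * N"
  let ?v = "\<lambda>i. (x (3 * i), x (3 * i + 1), x (3 * i + 2))"
  have "\<exists>T. \<forall>k<8. ?v (8 * q + k) = vel T (grid_point L M (8 * q + k))" if q: "q < ?K" for q
  proof -
    obtain a b c where cell: "cube_cell L M q = (a, b, c)" by (cases "cube_cell L M q")
    \<comment> \<open>The position difference of two corners of a cube does not depend on its cell,
      so up to the factor 2l every cube has the equations of \<open>cube_twist\<close>.\<close>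
    have pos: "pos l L M (8 * q + k) t - pos l L M (8 * q + k') t =
        l * (real (coord (corner_offset k) t) - real (coord (corner_offset k') t))"
      if "k < 8" "k' < 8" for k k' t
      unfolding pos_def grid_point_vertex[OF that(1)] grid_point_vertex[OF that(2)] cell
      by (simp add: corner_offset_def coord_def algebra_simps)
    have "(\<Sum>t<3. (real (coord (corner_offset (fst (cube_pairs ! s))) t) -
        real (coord (corner_offset (snd (cube_pairs ! s))) t)) *
      (x (3 * (8 * q + fst (cube_pairs ! s)) + t) - x (3 * (8 * q + snd (cube_pairs ! s)) + t))) = 0"
      (is "?S = 0") if s: "s < 18" for s
    proof -
      have "18 * q + s < 18 * ?K + 3 * card P" using q s by linarith
      from rows[OF this] have "2 * (l * ?S) = 0"
        unfolding cube_row[OF q s] pos[OF cube_pairs_bounds(1,2)[OF s]]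
        by (simp only: sum_distrib_left mult.assoc)
      then show ?thesis using l by simp
    qed
    from cube_twist[of "\<lambda>k t. x (3 * (8 * q + k) + t)", OF this, of "cube_cell L M q"]
    show ?thesis by (metis grid_point_vertex add.right_neutral)
  qed
  then obtain T where T: "\<And>q k. q < ?K \<Longrightarrow> k < 8 \<Longrightarrow> ?v (8 * q + k) = vel (T q) (grid_point L M (8 * q + k))"
    by metis
  have T_vertex: "?v (vertex L M c p) = vel (T (cell_index L M c)) p"
    if "c \<in> box L M N" "corner_of c p" for c p
    using T[OF cell_index_less[OF that(1)] corner_number(1)[OF that(2)]] vertex(3)[OF that]
    by (simp add: vertex_def)
  have link: "?v i = ?v k" if ik: "(i, k) \<in> P" for i k
  proof -
    have fin: "finite P" using E(2) by (simp add: P link_pattern_def)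
    have ik': "i < k" "k < 8 * ?K"
      using ik link_pattern_possible[OF E(1)] by (auto simp: P possible_links_def)
    have "x (3 * i + t) = x (3 * k + t)" if t: "t < 3" for t
      using link_row[OF fin ik ik' t, of l x] rows by (metis eq_iff_diff_eq_0)
    from this[of 0] this[of 1] this[of 2] show ?thesis by simp
  qed
  have "compatible (\<lambda>c. T (cell_index L M c)) E"
    unfolding compatible_def
  proof safe
    fix c d p assume e: "(c, d, p) \<in> E"
    then have cd: "c \<in> box L M N" "d \<in> box L M N" "corner_of c p" "corner_of d p"
      using E(1) by (auto simp: links_on_def)
    have "(min (vertex L M c p) (vertex L M d p), max (vertex L M c p) (vertex L M d p)) \<in> P"
      unfolding P link_pattern_def using e by (intro image_eqI[of _ _ "(c, d, p)"]) simp_all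
    from link[OF this] have "?v (vertex L M c p) = ?v (vertex L M d p)"
      by (cases "vertex L M c p \<le> vertex L M d p") (simp_all add: min_def max_def)
    then show "vel (T (cell_index L M c)) p = vel (T (cell_index L M d)) p"
      using T_vertex cd by metis
  qed
  from E(3)[OF this] have "T q = T 0" if "q < ?K" for q
    using cube_cell_in_box[OF that] cube_cell_in_box[OF K] cell_index_cube_cell by metis
  moreover have "T 0 = 0"
  proof -
    have "translate (cube_cell L M 0) p = p" for p
      by (cases p) (simp add: cube_cell_def)
    then have "vel (T 0) (corner_offset k) = ?v k" if "k < 8" for k
      using T[OF K that] grid_point_vertex[OF that, of L M 0] by simp
    \<comment> \<open>The origin at rest kills the translation, the two pinned coordinates of vertex
      1 kill w2 and w3, and the one of vertex 2 kills w1.\<close>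
    from this[of 0] this[of 1] this[of 2]
    have "vel (T 0) (0, 0, 0) = 0" "vel (T 0) (1, 0, 0) = (x 3, 0, 0)" "vel (T 0) (0, 1, 0) = (x 6, x 7, 0)"
      using pin by (simp_all add: corner_offset_def pinned_def zero_prod_def)
    then show ?thesis by (rule_tac twist_exhaust[of "T 0"]) (simp add: zero_prod_def)
  qed
  ultimately have zero: "?v (8 * q + k) = 0" if "q < ?K" "k < 8" for q k
    \<comment> \<open>The instance \<open>vel_diff[of 0 0]\<close> says that the zero twist has zero
      velocity everywhere.\<close>
    using T[OF that] that vel_diff[of 0 0] by simp
  have "j div 24 < ?K" using j by (simp add: less_mult_imp_div_less mult.commute)
  moreover have "j div 3 mod 8 < 8" by simp
  ultimately have "?v (8 * (j div 24) + j div 3 mod 8) = 0" by (rule zero)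
  moreover have "8 * (j div 24) + j div 3 mod 8 = j div 3"
    using div_mult2_eq[of j 3 8] by simp
  ultimately have "x (3 * (j div 3)) = 0" "x (3 * (j div 3) + 1) = 0" "x (3 * (j div 3) + 2) = 0"
    by (simp_all add: zero_prod_def)
  moreover have "j = 3 * (j div 3) \<or> j = 3 * (j div 3) + 1 \<or> j = 3 * (j div 3) + 2" by presburger
  ultimately show ?thesis by metis
qed

section \<open>The two bounds on the number of links\<close>

lemma rigidifies_card_ge:
  assumes "rigidifies l L M N P"
  shows "2 * (L * M * N) - 2 \<le> card P"
proof -
  have dim: "dim_row (rigidity_matrix l L M N P) = 18 * (L * M * N) + 3 * card P"
    using rigidity_matrix_carrier by blast
  have "24 * (L * M * N) - vec_space.rank (18 * (L * M * N) + 3 * card P)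
      (rigidity_matrix l L M N P) = 6"
    using assms unfolding rigidifies_def dof_def dim by blast
  moreover have "vec_space.rank (18 * (L * M * N) + 3 * card P) (rigidity_matrix l L M N P)
      \<le> 18 * (L * M * N) + 3 * card P"
    by (rule rank_le_nr[OF rigidity_matrix_carrier])
  \<comment> \<open>As the truncated difference is 6 and not 0, the rank is exactly 24K - 6; being
    at most 18K + 3n, it forces n to be at least 2K - 2.\<close>
  ultimately show ?thesis by linarith
qed

lemma tight_box_imp_rigidifies:
  assumes "tight (box L M N)" "l > 0" "0 < L * M * N"
  obtains P where "rigidifies l L M N P" "card P = 2 * (L * M * N) - 2"
proof -
  let ?K = "L * M * N"
  have "card (box L M N) = ?K" by (simp add: box_def card_cartesian_product)
  then obtain E where E: "E \<subseteq> links_on (box L M N)" "finite E" "card E + 2 \<le> 2 * ?K"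
      "\<And>T. compatible T E \<Longrightarrow> \<forall>c\<in>box L M N. \<forall>d\<in>box L M N. T c = T d"
    using assms(1) unfolding tight_def by auto
  define P where "P = link_pattern L M E"
  let ?A = "rigidity_matrix l L M N P" and ?nr = "18 * ?K + 3 * card P"
  have "card P \<le> card E" unfolding P_def link_pattern_def by (rule card_image_le[OF E(2)])
  then have card: "card P + 2 \<le> 2 * ?K" using E(3) by linarith
  have "card ({..<24 * ?K} - pinned) \<le> vec_space.rank ?nr ?A"
  proof (rule card_le_rank[OF rigidity_matrix_carrier])
    fix x assume x: "\<And>i. i < ?nr \<Longrightarrow> (\<Sum>j\<in>{..<24 * ?K} - pinned. ?A $$ (i, j) * x j) = 0"
    \<comment> \<open>A solution in the unpinned unknowns extends by zero to a kernel vector of the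
      whole matrix.\<close>
    define y where "y = (\<lambda>j. if j \<in> pinned then 0 else x j)"
    have "(\<Sum>j<24 * ?K. ?A $$ (i, j) * y j) = 0" if "i < ?nr" for i
    proof -
      have "(\<Sum>j<24 * ?K. ?A $$ (i, j) * y j) = (\<Sum>j\<in>{..<24 * ?K} - pinned. ?A $$ (i, j) * x j)"
        by (intro sum.mono_neutral_cong_right) (auto simp: y_def)
      with x[OF that] show ?thesis by simp
    qed
    then have "y j = 0" if "j < 24 * ?K" for j
      using motion_zero[OF assms(2,3) E(1,2,4) P_def, of y j] that by (simp add: y_def)
    then show "\<forall>j\<in>{..<24 * ?K} - pinned. x j = 0"
      unfolding y_def by (metis DiffD1 DiffD2 lessThan_iff)
  qed auto
  moreover have "card ({..<24 * ?K} - pinned) = 24 * ?K - 6"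
  proof -
    have "24 \<le> 24 * ?K" using assms(3) by linarith
    moreover have "pinned \<subseteq> {..<24}" by (simp add: pinned_def)
    ultimately have "pinned \<subseteq> {..<24 * ?K}" by (meson lessThan_subset_iff order_trans)
    then show ?thesis by (subst card_Diff_subset) (auto simp: pinned_def)
  qed
  moreover have "vec_space.rank ?nr ?A \<le> ?nr" by (rule rank_le_nr[OF rigidity_matrix_carrier])
  \<comment> \<open>The independent columns give rank at least 24K - 6. With at most 2K - 2 links
    the number of rows is at most 24K - 6, so the rank is exact without exhibiting the six rigid
    motions in the kernel.\<close>
  ultimately have "24 * ?K - vec_space.rank ?nr ?A = 6" using card assms(3) by linarith
  moreover have "dim_row ?A = ?nr" using rigidity_matrix_carrier by blast
  ultimately have "dof l L M N P = 6" unfolding dof_def by simp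
  then have rig: "rigidifies l L M N P"
    using link_pattern_possible[OF E(1)] unfolding rigidifies_def P_def by blast
  \<comment> \<open>The tight set gives only an upper bound on the number of links; the general
    lower bound now turns it into an equality.\<close>
  then have "card P = 2 * ?K - 2" using rigidifies_card_ge card by fastforce
  with rig show ?thesis using that by blast
qed

theorem theorem1:
  fixes l :: real and L :: nat
  assumes "l > 0" and "L \<ge> 2"
  shows "delta3D l L L L = 2 * L ^ 3 - 2"
proof -
  have "0 < L * L * L" using assms(2) by simp
  then obtain P where "rigidifies l L L L P" "card P = 2 * (L * L * L) - 2"
    using tight_box_imp_rigidifies[OF tight_cube[OF assms(2)] assms(1)] by blast
  then have "delta3D l L L L = 2 * (L * L * L) - 2"
    unfolding delta3D_def using rigidifies_card_ge by (intro Least_equality) blast+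
  then show ?thesis by (simp add: power3_eq_cube)
qed

end
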